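(* Let $n > 3$ and let $P_1,\dots,P_n$ be $n$ distinct points of the Euclidean plane, no three of which lie on one straight line, such that the distance between every two of them is a natural number. Then each of these distances is greater than $1$.
   Context: Natural numbers are the positive integers. *)

theory Defs
  imports "HOL-Analysis.Analysis"
begin

end

theory Submission
  imports Defs
begin

text \<open>
  Suppose that two of the points, \<open>A\<close> and \<open>B\<close>, are at distance 1. For a third point \<open>C\<close> off
  the line \<open>AB\<close> the triangle inequality is strict, so the integers \<open>AC\<close> and \<open>BC\<close> differ by less
  than 1 and are equal: \<open>C\<close> lies on the perpendicular bisector of \<open>AB\<close>
  (\<open>equidistant_of_unit_segment\<close>). As there are at least four points, there are two such points
  \<open>C\<close> and \<open>D\<close> on the bisector; let \<open>x\<close> and \<open>y\<close> be their signed distances from the midpoint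
  of \<open>AB\<close>. By Pythagoras, \<open>x\<^sup>2 + 1/4\<close> is the square of the integer \<open>a = AC\<close>, and
  \<open>y\<^sup>2 + 1/4\<close> that of \<open>AD\<close>; moreover \<open>x - y\<close> is a nonzero integer. Now \<open>x\<^sup>2 - y\<^sup>2\<close> and \<open>x - y\<close> are rational, hence so is \<open>x\<close>, and
  the integer \<open>4 * x\<^sup>2 = 4 * a\<^sup>2 - 1\<close> is the square of a rational, hence of an
  integer. But a square is never congruent to 3 modulo 4 (\<open>no_integral_heights\<close>).
\<close>

lemma four_mult_minus_one_not_square:
  fixes t m :: int
  shows "t\<^sup>2 \<noteq> 4 * m - 1"
proof
  assume eq: "t\<^sup>2 = 4 * m - 1"
  show False
  proof (cases "even t")
    case True
    then obtain r where "t = 2 * r" by (rule evenE)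
    with eq have "4 * (m - r\<^sup>2) = 1" by (simp add: power2_eq_square algebra_simps)
    then show False by presburger
  next
    case False
    then obtain r where "t = 2 * r + 1" by (rule oddE)
    with eq have "4 * (m - r\<^sup>2 - r) = 2" by (simp add: power2_eq_square algebra_simps)
    then show False by presburger
  qed
qed

text \<open>
  Clearing denominators makes the rationality argument one about integers: with \<open>d = \<bar>x - y\<bar>\<close>,
  multiplying \<open>2 * x = (x - y) + (x\<^sup>2 - y\<^sup>2) / (x - y)\<close> by \<open>x - y\<close> and squaring gives
  \<open>(4 * a\<^sup>2 - 1) * d\<^sup>2 = (d\<^sup>2 + a\<^sup>2 - b\<^sup>2)\<^sup>2\<close>, and the factor \<open>d\<^sup>2\<close> can be cancelled.
\<close>

lemma no_integral_heights:
  fixes x y :: real and a b d :: int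
  assumes a: "x\<^sup>2 + 1/4 = (of_int a)\<^sup>2"
    and b: "y\<^sup>2 + 1/4 = (of_int b)\<^sup>2"
    and d: "\<bar>x - y\<bar> = of_int d" "d \<noteq> 0"
  shows False
proof -
  define N where "N = d\<^sup>2 + a\<^sup>2 - b\<^sup>2"
  have d2: "(of_int d)\<^sup>2 = (x - y)\<^sup>2"
    using d(1) by (metis power2_abs)
  have "of_int N = (x - y)\<^sup>2 + x\<^sup>2 - y\<^sup>2"
    using a b d2 by (simp add: N_def)
  also have "\<dots> = 2 * x * (x - y)"
    by (simp add: power2_eq_square algebra_simps)
  finally have "(of_int N)\<^sup>2 = (4 * x\<^sup>2) * (x - y)\<^sup>2"
    by (simp add: power_mult_distrib)
  also have "\<dots> = (4 * (of_int a)\<^sup>2 - 1) * (of_int d)\<^sup>2"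
    using a d2 by simp
  finally have "real_of_int (N\<^sup>2) = of_int ((4 * a\<^sup>2 - 1) * d\<^sup>2)"
    by simp
  then have N: "N\<^sup>2 = (4 * a\<^sup>2 - 1) * d\<^sup>2"
    by (simp only: of_int_eq_iff)
  then have "d\<^sup>2 dvd N\<^sup>2" by simp
  then have "d dvd N" by simp
  then obtain t where "N = d * t" by (rule dvdE)
  with N d(2) have "t\<^sup>2 = 4 * a\<^sup>2 - 1"
    by (simp add: power_mult_distrib)
  then show False
    by (simp add: four_mult_minus_one_not_square)
qed

lemma equidistant_of_unit_segment:
  fixes A B C :: "'a::euclidean_space" and a b :: nat
  assumes AB: "dist A B = 1" and nc: "\<not> collinear {A, B, C}"
    and a: "dist A C = real a" and b: "dist B C = real b"
  shows "dist A C = dist B C"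
proof -
  have "dist A C \<noteq> dist A B + dist B C"
    using nc between_imp_collinear[of A C B] between[of A C B]
    by (auto simp: insert_commute)
  moreover have "dist B C \<noteq> dist B A + dist A C"
    using nc between_imp_collinear[of B C A] between[of B C A]
    by (auto simp: insert_commute)
  moreover have "dist A C \<le> dist A B + dist B C" "dist B C \<le> dist B A + dist A C"
    by (rule dist_triangle)+
  ultimately have "real a < 1 + real b" "real b < 1 + real a"
    using AB a b by (simp_all add: dist_commute)
  then show ?thesis using a b by simp
qed

text \<open>
  The vector \<open>B - A\<close>, rotated by a right angle, is a unit vector along the bisector. Measuring
  with the same vector for every \<open>C\<close> turns distances between points of the bisector into
  differences of their parameters.
\<close>

lemma perpendicular_bisector_parametrization:
  fixes A B C :: "real^2"
  assumes AB: "dist A B = 1" and eq: "dist A C = dist B C"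
  obtains x where "C = midpoint A B + x *\<^sub>R vector [A$2 - B$2, B$1 - A$1]"
proof
  define p q u v where "p = B$1 - A$1" and "q = B$2 - A$2"
    and "u = C$1 - (A$1 + B$1) / 2" and "v = C$2 - (A$2 + B$2) / 2"
  have unit: "p\<^sup>2 + q\<^sup>2 = 1"
    using AB by (simp add: dist_vec_def L2_set_def sum_2 dist_real_def p_def q_def power2_commute)
  have "(C$1 - A$1)\<^sup>2 + (C$2 - A$2)\<^sup>2 = (C$1 - B$1)\<^sup>2 + (C$2 - B$2)\<^sup>2"
    using eq by (simp add: dist_vec_def L2_set_def sum_2 dist_real_def power2_commute)
  then have orth: "u * p + v * q = 0"
    unfolding p_def q_def u_def v_def by (simp add: power2_eq_square field_simps)
  have "u = - (v * p - u * q) * q" "v = (v * p - u * q) * p"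
    using unit orth by algebra+
  then show "C = midpoint A B + (v * p - u * q) *\<^sub>R vector [A$2 - B$2, B$1 - A$1]"
    by (simp add: vec_eq_iff forall_2 midpoint_def p_def q_def u_def v_def field_simps)
qed

text \<open>
  Both \<open>C\<close> and \<open>D\<close> lie on the perpendicular bisector of \<open>AB\<close>, and their signed heights
  over the midpoint satisfy the equations excluded by \<open>no_integral_heights\<close>.
\<close>

lemma no_unit_distance_four_points:
  fixes A B C D :: "real^2" and a a' b b' d :: nat
  assumes AB: "dist A B = 1"
    and nc: "\<not> collinear {A, B, C}" "\<not> collinear {A, B, D}"
    and C: "dist A C = real a" "dist B C = real a'"
    and D: "dist A D = real b" "dist B D = real b'"
    and CD: "dist C D = real d" "d > 0"
  shows False
proof -
  define e :: "real^2" where "e = vector [A$2 - B$2, B$1 - A$1]"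
  obtain x where x: "C = midpoint A B + x *\<^sub>R e"
    using perpendicular_bisector_parametrization[OF AB equidistant_of_unit_segment[OF AB nc(1) C]]
    unfolding e_def by blast
  obtain y where y: "D = midpoint A B + y *\<^sub>R e"
    using perpendicular_bisector_parametrization[OF AB equidistant_of_unit_segment[OF AB nc(2) D]]
    unfolding e_def by blast
  have unit: "(B$1 - A$1)\<^sup>2 + (B$2 - A$2)\<^sup>2 = 1"
    using AB by (simp add: dist_vec_def L2_set_def sum_2 dist_real_def power2_commute)
  have e: "norm e = 1"
    using unit by (simp add: e_def norm_vec_def L2_set_def sum_2 power2_commute add.commute)
  have height: "(dist A (midpoint A B + h *\<^sub>R e))\<^sup>2 = h\<^sup>2 + 1/4" for h
  proof -
    have "(dist A (midpoint A B + h *\<^sub>R e))\<^sup>2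
        = (A$1 - ((A$1 + B$1) / 2 + h * (A$2 - B$2)))\<^sup>2
          + (A$2 - ((A$2 + B$2) / 2 + h * (B$1 - A$1)))\<^sup>2"
      by (simp add: dist_vec_def L2_set_def sum_2 dist_real_def midpoint_def e_def)
    also have "\<dots> = (h\<^sup>2 + 1/4) * ((B$1 - A$1)\<^sup>2 + (B$2 - A$2)\<^sup>2)"
      by (simp add: power2_eq_square field_simps)
    finally show ?thesis using unit by simp
  qed
  have "dist C D = norm ((x - y) *\<^sub>R e)"
    by (simp add: x y dist_norm algebra_simps)
  then have "\<bar>x - y\<bar> = of_int (int d)"
    using CD(1) e by simp
  moreover have "x\<^sup>2 + 1/4 = (of_int (int a))\<^sup>2"
    using height[of x] C(1) x by simp
  moreover have "y\<^sup>2 + 1/4 = (of_int (int b))\<^sup>2"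
    using height[of y] D(1) y by simp
  ultimately show False
    using no_integral_heights[of x "int a" y "int b" "int d"] CD(2) by simp
qed

theorem theorem2:
  fixes n :: nat and P :: "nat \<Rightarrow> real^2"
  assumes "n > 3"
    and "inj_on P {1..n}"
    and "\<And>i j k. \<lbrakk>i \<in> {1..n}; j \<in> {1..n}; k \<in> {1..n}; i \<noteq> j; j \<noteq> k; i \<noteq> k\<rbrakk>
           \<Longrightarrow> \<not> collinear {P i, P j, P k}"
    and "\<And>i j. \<lbrakk>i \<in> {1..n}; j \<in> {1..n}; i \<noteq> j\<rbrakk>
           \<Longrightarrow> \<exists>d::nat. d > 0 \<and> dist (P i) (P j) = real d"
  shows "\<forall>i\<in>{1..n}. \<forall>j\<in>{1..n}. i \<noteq> j \<longrightarrow> dist (P i) (P j) > 1"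
proof (intro ballI impI, rule ccontr)
  fix i j
  assume ij: "i \<in> {1..n}" "j \<in> {1..n}" "i \<noteq> j" and "\<not> dist (P i) (P j) > 1"
  then have unit: "dist (P i) (P j) = 1"
    using assms(4)[OF ij] by auto
  have "card {i, j} = 2" using ij(3) by simp
  then have "2 \<le> card ({1..n} - {i, j})"
    using assms(1) ij by (simp add: card_Diff_subset)
  then obtain S where "S \<subseteq> {1..n} - {i, j}" "card S = 2"
    by (meson obtain_subset_with_card_n)
  then obtain k l where kl: "k \<in> {1..n}" "l \<in> {1..n}" "k \<noteq> l"
      "k \<noteq> i" "k \<noteq> j" "l \<noteq> i" "l \<noteq> j"
    by (auto simp: card_2_iff)
  obtain a where a: "dist (P i) (P k) = real a" using assms(4)[of i k] ij kl by blast
  obtain a' where a': "dist (P j) (P k) = real a'" using assms(4)[of j k] ij kl by blast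
  obtain b where b: "dist (P i) (P l) = real b" using assms(4)[of i l] ij kl by blast
  obtain b' where b': "dist (P j) (P l) = real b'" using assms(4)[of j l] ij kl by blast
  obtain d where d: "dist (P k) (P l) = real d" "d > 0" using assms(4)[of k l] kl by blast
  have "\<not> collinear {P i, P j, P k}" "\<not> collinear {P i, P j, P l}"
    using assms(3) ij kl by metis+
  then show False
    using no_unit_distance_four_points[OF unit _ _ a a' b b' d] by blast
qed

end
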